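(* Let $0<\ell_{\star\star}<\psi_{\star\star}<\infty$ be such that $\lambda_{\min}(\hat\theta)>\ell_{\star\star}$ and $\lambda_{\max}(\hat\theta)<\psi_{\star\star}$. Let $\{\theta_k,\ k\ge0\}$ be a sequence in $\mathcal{M}_+$ with $\theta_{j+1}=T_\gamma(\theta_j;\alpha)$ for all $j\ge 0$, for some $\gamma\in(0,\ell_{\star\star}^2]$. If $\lim_k\theta_k=\hat\theta$, then there exists $k_0\ge0$ such that for all $k\ge k_0$, $$\|\theta_k-\hat\theta\|_F^2\le\left(1-\frac{\gamma}{\psi_{\star\star}^2}\right)^{k-k_0}\|\theta_{k_0}-\hat\theta\|_F^2.$$
   Context: $\mathcal{M}$ is the set of real symmetric $p\times p$ matrices with inner product $\langle A,B\rangle=\mathrm{Tr}(A'B)$ and Frobenius norm $\|A\|_F$; $\mathcal{M}_+\subset\mathcal{M}$ is the set of positive definite matrices, and $\lambda_{\min},\lambda_{\max}$ denote smallest and largest eigenvalues. $S$ is a fixed $p\times p$ symmetric positive semidefinite matrix; $\lambda>0$ and $\alpha\in(0,1]$ are fixed. Let $f(\theta)=-\log\det\theta+\mathrm{Tr}(\theta S)$ for $\theta\in\mathcal{M}_+$, $g_\alpha(\theta)=\sum_{i,j}\left(\alpha\lambda|\theta_{ij}|+\frac{1-\alpha}{2}\lambda\theta_{ij}^2\right)$, and $\phi_\alpha=f+g_\alpha$. $\hat\theta$ denotes the (unique) minimizer of $\phi_\alpha$ over $\mathcal{M}_+$. For $\gamma>0$ and $\theta\in\mathcal{M}_+$ (the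 domain of $T_\gamma(\cdot;\alpha)$), $$T_\gamma(\theta;\alpha)=\operatorname{argmin}_{u\in\mathcal{M}}\left\{g_\alpha(u)+\frac{1}{2\gamma}\|u-\theta+\gamma(S-\theta^{-1})\|_F^2\right\}.$$ *)

theory Defs
  imports "HOL-Analysis.Analysis"
begin

definition sym_mats :: "(real^'n^'n) set" where
  "sym_mats = {A. transpose A = A}"

definition pd_mats :: "(real^'n^'n) set" where
  "pd_mats = {A \<in> sym_mats. \<forall>x. x \<noteq> 0 \<longrightarrow> x \<bullet> (A *v x) > 0}"

definition psd_mats :: "(real^'n^'n) set" where
  "psd_mats = {A \<in> sym_mats. \<forall>x. x \<bullet> (A *v x) \<ge> 0}"

definition eigenvalues :: "real^'n^'n \<Rightarrow> real set" where
  "eigenvalues A = {c. \<exists>v. v \<noteq> 0 \<and> A *v v = c *\<^sub>R v}"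

(* Meaningful for symmetric matrices only: their set of real eigenvalues is finite and nonempty. *)
definition lambda_min :: "real^'n^'n \<Rightarrow> real" where
  "lambda_min A = Min (eigenvalues A)"

definition lambda_max :: "real^'n^'n \<Rightarrow> real" where
  "lambda_max A = Max (eigenvalues A)"

(* The inner product and norm of the type real^'n^'n are the trace inner product
   and the Frobenius norm. *)
lemma inner_eq_trace: "A \<bullet> B = trace (transpose A ** B)" for A B :: "real^'n^'n"
proof -
  have "A \<bullet> B = (\<Sum>i\<in>UNIV. \<Sum>j\<in>UNIV. A $ i $ j * B $ i $ j)"
    by (simp add: inner_vec_def)
  also have "\<dots> = (\<Sum>j\<in>UNIV. \<Sum>i\<in>UNIV. A $ i $ j * B $ i $ j)"
    by (rule sum.swap)
  finally show ?thesis
    by (simp add: trace_def matrix_matrix_mult_def transpose_def)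
qed

lemma norm_eq_frobenius: "norm A = sqrt (trace (transpose A ** A))" for A :: "real^'n^'n"
  by (simp add: norm_eq_sqrt_inner inner_eq_trace)

definition f_obj :: "real^'n^'n \<Rightarrow> real^'n^'n \<Rightarrow> real" where
  "f_obj S \<theta> = - ln (det \<theta>) + trace (\<theta> ** S)"

definition g_pen :: "real \<Rightarrow> real \<Rightarrow> real^'n^'n \<Rightarrow> real" where
  "g_pen lam \<alpha> \<theta> =
    (\<Sum>i\<in>UNIV. \<Sum>j\<in>UNIV.
      \<alpha> * lam * \<bar>\<theta> $ i $ j\<bar> + (1 - \<alpha>) / 2 * lam * (\<theta> $ i $ j)\<^sup>2)"

definition phi_obj :: "real^'n^'n \<Rightarrow> real \<Rightarrow> real \<Rightarrow> real^'n^'n \<Rightarrow> real" where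
  "phi_obj S lam \<alpha> \<theta> = f_obj S \<theta> + g_pen lam \<alpha> \<theta>"

(* Meaningful for positive definite \<theta>; the minimised function is then strongly convex on the
   space of symmetric matrices, so its minimiser exists and is unique. *)
definition T_map ::
  "real^'n^'n \<Rightarrow> real \<Rightarrow> real \<Rightarrow> real \<Rightarrow> real^'n^'n \<Rightarrow> real^'n^'n" where
  "T_map S lam \<alpha> \<gamma> \<theta> =
    arg_min (\<lambda>u. g_pen lam \<alpha> u
                + 1 / (2 * \<gamma>) * (norm (u - \<theta> + \<gamma> *\<^sub>R (S - matrix_inv \<theta>)))\<^sup>2)
            (\<lambda>u. u \<in> sym_mats)"

end

(* Let P be an iterate, M the minimiser, D = P - M and N = M^-1 - P^-1, so that D = P N M.
   Adding the optimality conditions of the proximal step at P and of M shows that the next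
   iterate lies within |D - \<gamma> N| of M. The map N |-> P N M is the tensor product of two positive
   definite forms, so near M its quadratic form is bounded below by l^2, and that of its inverse by
   1/\<psi>^2; with \<gamma> <= l^2,
     |D - \<gamma> N|^2 = |D|^2 - 2 \<gamma> <D, N> + \<gamma>^2 |N|^2 <= |D|^2 - \<gamma> <D, N> <= (1 - \<gamma>/\<psi>^2) |D|^2. *)

theory Submission
  imports Defs
begin

section \<open>Symmetric matrices and positive semidefinite quadratic forms\<close>

lemma dot_matrix_mult_left: "(A *v x) \<bullet> y = x \<bullet> (transpose A *v y)"
  for A :: "real^'n^'m"
  by (metis dot_lmul_matrix inner_commute vector_transpose_matrix)

lemma sym_mats_dot: "A \<in> sym_mats \<Longrightarrow> (A *v x) \<bullet> y = x \<bullet> (A *v y)"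
  by (simp add: dot_matrix_mult_left sym_mats_def)

lemma sym_mats_nth: "A \<in> sym_mats \<Longrightarrow> A $ i $ j = A $ j $ i"
  by (metis (mono_tags) mem_Collect_eq sym_mats_def transpose_def vec_lambda_beta)

lemma sym_matsI: "(\<And>i j. A $ i $ j = A $ j $ i) \<Longrightarrow> A \<in> sym_mats"
  by (simp add: sym_mats_def transpose_def vec_eq_iff)

lemma subspace_sym_mats: "subspace sym_mats"
  by (auto simp: subspace_def sym_mats_def transpose_def vec_eq_iff)

lemma mat_in_sym_mats: "mat c \<in> sym_mats"
  by (rule sym_matsI) (auto simp: mat_def)

lemma psd_matsD: "A \<in> psd_mats \<Longrightarrow> x \<bullet> (A *v x) \<ge> 0"
  by (simp add: psd_mats_def)

lemma quadratic_form_add: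
  assumes "A \<in> sym_mats"
  shows "(x + t *\<^sub>R y) \<bullet> (A *v (x + t *\<^sub>R y)) =
    x \<bullet> (A *v x) + 2 * t * (x \<bullet> (A *v y)) + t\<^sup>2 * (y \<bullet> (A *v y))"
  using sym_mats_dot[OF assms, of x y]
  by (simp add: matrix_vector_right_distrib matrix_vector_mult_scaleR inner_add_left inner_add_right
      algebra_simps power2_eq_square inner_commute)

text \<open>The form is nonnegative along the line x + t y, so this quadratic polynomial in t has
  nonpositive discriminant. Semidefiniteness allows the leading coefficient to vanish, which is a
  separate case.\<close>

lemma psd_Cauchy_Schwarz:
  assumes "A \<in> psd_mats"
  shows "(x \<bullet> (A *v y))\<^sup>2 \<le> (x \<bullet> (A *v x)) * (y \<bullet> (A *v y))"
proof -
  have A: "A \<in> sym_mats" using assms by (simp add: psd_mats_def)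
  define a b c where "a = x \<bullet> (A *v x)" and "b = x \<bullet> (A *v y)" and "c = y \<bullet> (A *v y)"
  have nonneg: "a + 2 * t * b + t\<^sup>2 * c \<ge> 0" for t
    using psd_matsD[OF assms, of "x + t *\<^sub>R y"] quadratic_form_add[OF A]
    by (simp add: a_def b_def c_def)
  have c: "c \<ge> 0" using assms by (simp add: c_def psd_matsD)
  show ?thesis unfolding a_def[symmetric] b_def[symmetric] c_def[symmetric]
  proof (cases "c = 0")
    case True
    have "b = 0"
    proof (rule ccontr)
      assume "b \<noteq> 0"
      \<comment> \<open>With c = 0 this choice of t gives the polynomial the value -1.\<close>
      then show False using nonneg[of "- (a + 1) / (2 * b)"] True by (simp add: field_simps)
    qed
    then show "b\<^sup>2 \<le> a * c" using True by simp
  next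
    case False
    with c have "c > 0" by simp
    \<comment> \<open>t = -b/c is the minimum point of the polynomial.\<close>
    then have "a + 2 * (- b / c) * b + (- b / c)\<^sup>2 * c = (a * c - b\<^sup>2) / c"
      by (simp add: field_simps power2_eq_square)
    then show "b\<^sup>2 \<le> a * c" using nonneg[of "- b / c"] \<open>c > 0\<close>
      by (simp add: zero_le_divide_iff)
  qed
qed

section \<open>Nonnegativity of the trace inner product of two semidefinite matrices\<close>

definition outer :: "real^'n \<Rightarrow> real^'n^'n" where
  "outer v = (\<chi> i j. v $ i * v $ j)"

lemma outer_mult_vec: "outer v *v x = (v \<bullet> x) *\<^sub>R v"
  by (simp add: outer_def matrix_vector_mult_def vec_eq_iff inner_vec_def sum_distrib_left
      sum_distrib_right mult_ac)

lemma outer_inner: "outer v \<bullet> A = v \<bullet> (A *v v)"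
  by (simp add: outer_def matrix_vector_mult_def inner_vec_def sum_distrib_left mult_ac)

text \<open>One step of Cholesky elimination at a nonzero diagonal entry strictly decreases the number
  of nonzero rows of the first matrix and splits off a rank-one matrix.\<close>

lemma psd_inner_nonneg:
  fixes A B :: "real^'n^'n"
  assumes "A \<in> psd_mats" "B \<in> psd_mats"
  shows "A \<bullet> B \<ge> 0"
  using assms(1)
proof (induction "card {i. A $ i \<noteq> 0}" arbitrary: A rule: less_induct)
  case less
  have A: "A \<in> sym_mats" using less.prems by (simp add: psd_mats_def)
  show ?case
  proof (cases "A = 0")
    case False
    then obtain i where i: "A $ i \<noteq> 0" by (auto simp: vec_eq_iff)
    define e where "e = (axis i 1 :: real^'n)"
    define v where "v = A *v e"
    have v_nth: "v $ j = A $ i $ j" for j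
      using sym_mats_nth[OF A, of i j] by (simp add: v_def e_def matrix_vector_mult_basis column_def)
    have ev: "e \<bullet> v = A $ i $ i" by (simp add: e_def inner_axis' v_nth)
    \<comment> \<open>This bound makes the remainder \<open>C\<close> semidefinite: the split-off
      rank-one form never exceeds the form of \<open>A\<close>.\<close>
    have CS: "(v \<bullet> x)\<^sup>2 \<le> A $ i $ i * (x \<bullet> (A *v x))" for x
      using psd_Cauchy_Schwarz[OF less.prems, of e x] ev
      by (simp add: v_def sym_mats_dot[OF A])
    have "v \<noteq> 0" using i v_nth by (auto simp: vec_eq_iff)
    then have "v \<bullet> v > 0" by simp
    \<comment> \<open>A zero pivot is impossible: Cauchy-Schwarz at x = v would then give (v . v)^2
      <= 0, although v is nonzero.\<close>
    moreover have nn: "A $ i $ i \<ge> 0"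
      using psd_matsD[OF less.prems, of e] ev by (simp add: v_def)
    ultimately have pos: "A $ i $ i > 0"
      using CS[of v] by (cases "A $ i $ i = 0") auto
    define C where "C = A - inverse (A $ i $ i) *\<^sub>R outer v"
    have Cv: "C *v x = A *v x - ((v \<bullet> x) / A $ i $ i) *\<^sub>R v" for x
      by (simp add: C_def matrix_vector_mult_diff_rdistrib outer_mult_vec
          scaleR_matrix_vector_assoc[symmetric] divide_inverse mult.commute)
    have "outer v \<in> sym_mats"
      by (rule sym_matsI) (simp add: outer_def)
    then have "C \<in> sym_mats"
      unfolding C_def using A subspace_sym_mats
      by (intro subspace_diff subspace_scale) auto
    moreover have "x \<bullet> (C *v x) \<ge> 0" for x
      using CS[of x] pos
      by (simp add: Cv inner_diff_right inner_commute[of x v] field_simps power2_eq_square)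
    ultimately have "C \<in> psd_mats" by (simp add: psd_mats_def)
    moreover have "card {j. C $ j \<noteq> 0} < card {j. A $ j \<noteq> 0}"
    proof (rule psubset_card_mono)
      have Cnth: "C $ j $ k = A $ j $ k - A $ i $ j * A $ i $ k / A $ i $ i" for j k
        by (simp add: C_def outer_def v_nth divide_inverse mult_ac)
      \<comment> \<open>Row i is eliminated. A zero row j of \<open>A\<close> stays zero because the
        multiplier \<open>A $ i $ j\<close> vanishes by symmetry.\<close>
      have "C $ i = 0" using pos by (simp add: vec_eq_iff Cnth)
      moreover have "C $ j = 0" if "A $ j = 0" for j
        using that sym_mats_nth[OF A, of i j] by (simp add: vec_eq_iff Cnth)
      ultimately show "{j. C $ j \<noteq> 0} \<subset> {j. A $ j \<noteq> 0}" using i by blast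
    qed simp
    ultimately have "C \<bullet> B \<ge> 0" by (rule less.hyps[rotated])
    moreover have "A \<bullet> B = C \<bullet> B + inverse (A $ i $ i) * (v \<bullet> (B *v v))"
      by (simp add: C_def inner_diff_left outer_inner)
    ultimately show ?thesis
      using pos psd_matsD[OF assms(2), of v] by (simp add: less_imp_le)
  qed simp
qed

section \<open>The quadratic form of N |-> A N B\<close>

lemma inner_mult_left: "(X ** Y) \<bullet> Z = Y \<bullet> (transpose X ** Z)" for X Y Z :: "real^'n^'n"
  by (simp add: inner_eq_trace matrix_transpose_mul matrix_mul_assoc)

lemma inner_mult_right: "(Y ** X) \<bullet> Z = Y \<bullet> (Z ** transpose X)" for X Y Z :: "real^'n^'n"
proof -
  have "trace (transpose X ** (transpose Y ** Z)) = trace ((transpose Y ** Z) ** transpose X)"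
    by (rule trace_mul_sym)
  then show ?thesis
    by (simp add: inner_eq_trace matrix_transpose_mul matrix_mul_assoc)
qed

lemma psd_congruence:
  fixes A N :: "real^'n^'n"
  assumes "A \<in> psd_mats"
  shows "transpose N ** A ** N \<in> psd_mats"
proof -
  have "transpose A = A" using assms by (simp add: psd_mats_def sym_mats_def)
  then have "transpose N ** A ** N \<in> sym_mats"
    by (simp add: sym_mats_def matrix_transpose_mul matrix_mul_assoc)
  moreover have "x \<bullet> ((transpose N ** A ** N) *v x) = (N *v x) \<bullet> (A *v (N *v x))" for x
    by (simp add: dot_matrix_mult_left matrix_vector_mul_assoc matrix_mul_assoc)
  ultimately show ?thesis using assms by (simp add: psd_mats_def)
qed

text \<open>Moving factors across the inner product turns the form into <B, N' A N>, a pairing of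
  two semidefinite matrices.\<close>

lemma psd_sandwich_nonneg:
  fixes A N :: "real^'n^'n"
  assumes "A \<in> psd_mats" "B \<in> psd_mats"
  shows "(A ** N ** B) \<bullet> N \<ge> 0"
proof -
  have [simp]: "transpose A = A" "transpose B = B"
    using assms by (auto simp: psd_mats_def sym_mats_def)
  have "(A ** N ** B) \<bullet> N = (N ** B) \<bullet> (A ** N)"
    by (metis inner_mult_left matrix_mul_assoc \<open>transpose A = A\<close>)
  also have "\<dots> = B \<bullet> (transpose N ** A ** N)"
    by (simp add: inner_mult_left matrix_mul_assoc)
  finally show ?thesis
    using psd_inner_nonneg[OF assms(2) psd_congruence[OF assms(1)]] by simp
qed

lemma mat_1_psd: "mat 1 \<in> psd_mats"
  by (simp add: psd_mats_def mat_in_sym_mats)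

lemma matrix_add_rdistrib: "(A + B) ** C = A ** C + B ** C" for A B C :: "real^'n^'n"
  by (simp add: matrix_matrix_mult_def vec_eq_iff sum.distrib distrib_right)

text \<open>With P = A + l I and Q = B + l I, where A and B are semidefinite, P N Q expands into l^2
  N and three sandwiches of N between semidefinite matrices, whose pairings with N are
  nonnegative.\<close>

lemma sandwich_lower_bound:
  fixes P Q N :: "real^'n^'n"
  assumes "P \<in> sym_mats" "Q \<in> sym_mats" "l \<ge> 0"
    and P: "\<And>x. l * (x \<bullet> x) \<le> x \<bullet> (P *v x)" and Q: "\<And>x. l * (x \<bullet> x) \<le> x \<bullet> (Q *v x)"
  shows "l\<^sup>2 * (N \<bullet> N) \<le> (P ** N ** Q) \<bullet> N"
proof -
  have psd: "R - l *\<^sub>R mat 1 \<in> psd_mats"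
    if "R \<in> sym_mats" "\<And>x. l * (x \<bullet> x) \<le> x \<bullet> (R *v x)" for R
    using that subspace_diff[OF subspace_sym_mats that(1) subspace_scale[OF subspace_sym_mats mat_in_sym_mats]]
    by (simp add: psd_mats_def matrix_vector_mult_diff_rdistrib inner_diff_right
        scaleR_matrix_vector_assoc[symmetric])
  define A B where "A = P - l *\<^sub>R mat 1" and "B = Q - l *\<^sub>R mat 1"
  have AB: "A \<in> psd_mats" "B \<in> psd_mats"
    unfolding A_def B_def using assms psd by auto
  have PQ: "P = A + l *\<^sub>R mat 1" "Q = B + l *\<^sub>R mat 1" by (auto simp: A_def B_def)
  have "P ** N ** Q = A ** N ** B + l *\<^sub>R (A ** N ** mat 1) + l *\<^sub>R (mat 1 ** N ** B) + l\<^sup>2 *\<^sub>R N"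
    unfolding PQ matrix_add_ldistrib matrix_add_rdistrib
    by (simp add: scalar_matrix_assoc[symmetric] matrix_scalar_ac power2_eq_square)
  then show ?thesis
    using psd_sandwich_nonneg[OF AB, of N] psd_sandwich_nonneg[OF AB(1) mat_1_psd, of N]
      psd_sandwich_nonneg[OF mat_1_psd AB(2), of N] \<open>l \<ge> 0\<close>
    by (simp add: inner_add_left)
qed

section \<open>Inverses of positive definite matrices and contraction of the gradient step\<close>

lemma matrix_inv_mult:
  fixes A :: "real^'n^'n"
  assumes "invertible A"
  shows "A ** matrix_inv A = mat 1" "matrix_inv A ** A = mat 1"
  using someI_ex[OF assms[unfolded invertible_def]] unfolding matrix_inv_def by auto

lemma pd_invertible:
  assumes "A \<in> pd_mats"
  shows "invertible A"
proof -
  have "x = 0" if "A *v x = 0" for x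
    using assms that by (force simp: pd_mats_def)
  then show ?thesis
    by (simp add: invertible_left_inverse matrix_left_invertible_ker)
qed

lemma matrix_inv_sym:
  assumes "A \<in> sym_mats" "invertible A"
  shows "matrix_inv A \<in> sym_mats"
proof -
  let ?B = "matrix_inv A"
  have "transpose (?B ** A) = mat 1" "transpose A = A"
    using assms by (simp_all add: matrix_inv_mult sym_mats_def transpose_mat)
  then have "A ** transpose ?B = mat 1" by (simp add: matrix_transpose_mul)
  then have "?B ** A ** transpose ?B = ?B" by (simp add: matrix_mul_assoc[symmetric])
  then show ?thesis using assms by (simp add: matrix_inv_mult sym_mats_def)
qed

lemma pd_psd:
  assumes "A \<in> pd_mats"
  shows "A \<in> psd_mats"
proof -
  have "x \<bullet> (A *v x) \<ge> 0" for x
    using assms by (cases "x = 0") (auto simp: pd_mats_def less_imp_le)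
  then show ?thesis using assms by (simp add: pd_mats_def psd_mats_def)
qed

text \<open>For x = P^-1 y, Cauchy-Schwarz for the form of P at x and y reads |y|^4 <= (x . y) (y .
  P y), and the last factor is at most \<psi> |y|^2. Cancelling |y|^2 gives the bound without
  diagonalising P.\<close>

lemma matrix_inv_lower_bound:
  assumes P: "P \<in> pd_mats" and ub: "\<And>x. x \<bullet> (P *v x) \<le> \<psi> * (x \<bullet> x)" and "\<psi> > 0"
  shows "1 / \<psi> * (y \<bullet> y) \<le> y \<bullet> (matrix_inv P *v y)"
proof -
  have sym: "P \<in> sym_mats" using P by (simp add: pd_mats_def)
  have psd: "P \<in> psd_mats" using P by (rule pd_psd)
  define x where "x = matrix_inv P *v y"
  have y: "y = P *v x"
    using matrix_inv_mult[OF pd_invertible[OF P]] by (simp add: x_def matrix_vector_mul_assoc)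
  have xy: "x \<bullet> (P *v y) = y \<bullet> y" using sym_mats_dot[OF sym, of x y] y by simp
  have "(y \<bullet> y)\<^sup>2 \<le> (x \<bullet> y) * (y \<bullet> (P *v y))"
    using psd_Cauchy_Schwarz[OF psd, of x y] xy y by simp
  also have "\<dots> \<le> (x \<bullet> y) * (\<psi> * (y \<bullet> y))"
    using ub psd_matsD[OF psd, of x] y by (intro mult_left_mono) auto
  finally have *: "(y \<bullet> y) * (y \<bullet> y) \<le> (x \<bullet> y) * \<psi> * (y \<bullet> y)"
    by (simp add: power2_eq_square mult_ac)
  have "y \<bullet> y \<le> (x \<bullet> y) * \<psi>"
  proof (cases "y = 0")
    case False
    then show ?thesis using * by (simp add: mult_le_cancel_right)
  qed simp
  then show ?thesis
    using \<open>\<psi> > 0\<close> by (simp add: x_def inner_commute field_simps)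
qed

text \<open>The gradient of \<open>- ln det\<close> is \<open>- matrix_inv\<close>. Its increment \<open>N\<close> satisfies \<open>P - Q = P N Q\<close>, so
  both bounds below are instances of the sandwich inequality.\<close>

lemma gradient_step_contraction:
  fixes P Q :: "real^'n^'n"
  assumes P: "P \<in> pd_mats" and Q: "Q \<in> pd_mats"
    and lP: "\<And>x. l * (x \<bullet> x) \<le> x \<bullet> (P *v x)" and lQ: "\<And>x. l * (x \<bullet> x) \<le> x \<bullet> (Q *v x)"
    and uP: "\<And>x. x \<bullet> (P *v x) \<le> \<psi> * (x \<bullet> x)" and uQ: "\<And>x. x \<bullet> (Q *v x) \<le> \<psi> * (x \<bullet> x)"
    and "0 < l" "0 < \<psi>" "0 < \<gamma>" "\<gamma> \<le> l\<^sup>2"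
  shows "(norm ((P - Q) + \<gamma> *\<^sub>R (matrix_inv P - matrix_inv Q)))\<^sup>2
    \<le> (1 - \<gamma> / \<psi>\<^sup>2) * (norm (P - Q))\<^sup>2"
proof -
  have sym: "P \<in> sym_mats" "Q \<in> sym_mats" using P Q by (auto simp: pd_mats_def)
  note inv = pd_invertible[OF P] pd_invertible[OF Q]
  define D N where "D = P - Q" and "N = matrix_inv Q - matrix_inv P"
  have sub: "A ** (B - C) = A ** B - A ** C" "(B - C) ** A = B ** A - C ** A" for A B C :: "real^'n^'n"
    by (simp_all add: matrix_matrix_mult_def vec_eq_iff sum_subtractf algebra_simps)
  have "P ** N ** Q = P ** (matrix_inv Q ** Q) - (P ** matrix_inv P) ** Q"
    by (simp add: N_def sub matrix_mul_assoc)
  then have D: "P ** N ** Q = D" using inv by (simp add: matrix_inv_mult D_def)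
  have "matrix_inv P ** D ** matrix_inv Q
      = (matrix_inv P ** P) ** matrix_inv Q - matrix_inv P ** (Q ** matrix_inv Q)"
    by (simp add: D_def sub matrix_mul_assoc)
  then have N: "matrix_inv P ** D ** matrix_inv Q = N"
    using inv by (simp add: matrix_inv_mult N_def)
  have "\<gamma> * (N \<bullet> N) \<le> l\<^sup>2 * (N \<bullet> N)" using assms by (intro mult_right_mono) auto
  also have "\<dots> \<le> D \<bullet> N"
    using sandwich_lower_bound[OF sym _ lP lQ, of N] \<open>0 < l\<close> by (simp add: D)
  finally have "\<gamma> * (\<gamma> * (N \<bullet> N)) \<le> \<gamma> * (D \<bullet> N)"
    using \<open>0 < \<gamma>\<close> by simp
  \<comment> \<open>The sandwich bound is used a second time, now for the inverses with constant
    1/\<psi> and applied to D.\<close>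
  moreover have "1 / \<psi>\<^sup>2 * (D \<bullet> D) \<le> D \<bullet> N"
    using sandwich_lower_bound[OF matrix_inv_sym[OF sym(1) inv(1)] matrix_inv_sym[OF sym(2) inv(2)] _
        matrix_inv_lower_bound[OF P uP \<open>0 < \<psi>\<close>] matrix_inv_lower_bound[OF Q uQ \<open>0 < \<psi>\<close>], of D] \<open>0 < \<psi>\<close>
    by (simp add: N inner_commute power_divide)
  then have "\<gamma> * (1 / \<psi>\<^sup>2 * (D \<bullet> D)) \<le> \<gamma> * (D \<bullet> N)"
    using \<open>0 < \<gamma>\<close> by (intro mult_left_mono) auto
  moreover have "(norm (D - \<gamma> *\<^sub>R N))\<^sup>2 = D \<bullet> D - 2 * \<gamma> * (D \<bullet> N) + \<gamma> * (\<gamma> * (N \<bullet> N))"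
    unfolding power2_norm_eq_inner
    by (simp add: inner_diff_left inner_diff_right inner_commute algebra_simps)
  ultimately have "(norm (D - \<gamma> *\<^sub>R N))\<^sup>2 \<le> (1 - \<gamma> / \<psi>\<^sup>2) * (norm D)\<^sup>2"
    by (simp add: power2_norm_eq_inner left_diff_distrib)
  moreover have "D - \<gamma> *\<^sub>R N = (P - Q) + \<gamma> *\<^sub>R (matrix_inv P - matrix_inv Q)"
    by (simp add: D_def N_def algebra_simps)
  ultimately show ?thesis by (simp only: D_def)
qed

section \<open>Extreme eigenvalues as bounds of the quadratic form\<close>

text \<open>Eigenvectors of distinct eigenvalues are orthogonal, and a pairwise orthogonal set is
  finite. Finiteness is what gives \<open>Min\<close> and \<open>Max\<close> in
  \<open>lambda_min\<close> and \<open>lambda_max\<close> their meaning.\<close>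

lemma eigenvalues_finite:
  assumes "A \<in> sym_mats"
  shows "finite (eigenvalues A)"
proof -
  define v where "v c = (SOME v. v \<noteq> 0 \<and> A *v v = c *\<^sub>R v)" for c
  have v: "v c \<noteq> 0 \<and> A *v v c = c *\<^sub>R v c" if "c \<in> eigenvalues A" for c
    unfolding v_def by (rule someI_ex) (use that in \<open>simp add: eigenvalues_def\<close>)
  have orth: "v c \<bullet> v d = 0" if "c \<in> eigenvalues A" "d \<in> eigenvalues A" "c \<noteq> d" for c d
    using sym_mats_dot[OF assms, of "v c" "v d"] v[OF that(1)] v[OF that(2)] that(3) by auto
  then have "inj_on v (eigenvalues A)"
    using v by (intro inj_onI) (metis inner_eq_zero_iff)
  moreover have "pairwise orthogonal (v ` eigenvalues A)"
    using orth by (auto simp: pairwise_def orthogonal_def)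
  then have "finite (v ` eigenvalues A)" by (rule pairwise_orthogonal_imp_finite)
  ultimately show ?thesis by (simp add: finite_image_iff)
qed

text \<open>A minimiser of the Rayleigh quotient on the unit sphere is an eigenvector: with \<open>A - c I\<close>
  positive semidefinite, Cauchy-Schwarz puts it in the kernel.\<close>

lemma exists_minimal_eigenvalue:
  fixes A :: "real^'n^'n"
  assumes A: "A \<in> sym_mats"
  obtains c where "c \<in> eigenvalues A" "\<And>x. c * (x \<bullet> x) \<le> x \<bullet> (A *v x)"
proof -
  let ?q = "\<lambda>x. x \<bullet> (A *v x)"
  have "continuous_on (sphere 0 1) ?q"
    by (intro continuous_intros matrix_vector_mult_linear_continuous_on)
  \<comment> \<open>The index is arbitrary; the vector only witnesses that the sphere is
    nonempty.\<close>
  moreover have "axis undefined 1 \<in> sphere (0 :: real^'n) 1" by simp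
  ultimately obtain v :: "real^'n" where v: "norm v = 1" "\<And>x. norm x = 1 \<Longrightarrow> ?q v \<le> ?q x"
    using continuous_attains_inf[of "sphere (0 :: real^'n) 1" ?q] by force
  define c where "c = ?q v"
  have bound: "c * (x \<bullet> x) \<le> ?q x" for x
  proof (cases "x = 0")
    case False
    then have "c \<le> ?q (inverse (norm x) *\<^sub>R x)"
      using v(2)[of "inverse (norm x) *\<^sub>R x"] by (simp add: c_def)
    then have "c \<le> ?q x / (norm x)\<^sup>2"
      by (simp add: matrix_vector_mult_scaleR divide_inverse power2_eq_square mult_ac)
    then show ?thesis using False by (simp add: field_simps power2_norm_eq_inner)
  qed simp
  define B where "B = A - c *\<^sub>R mat 1"
  have Bx: "B *v x = A *v x - c *\<^sub>R x" for x
    by (simp add: B_def matrix_vector_mult_diff_rdistrib scaleR_matrix_vector_assoc[symmetric])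
  have "B \<in> sym_mats"
    unfolding B_def by (intro subspace_diff subspace_scale subspace_sym_mats A mat_in_sym_mats)
  then have "B \<in> psd_mats" using bound by (simp add: psd_mats_def Bx inner_diff_right)
  moreover have "v \<bullet> (B *v v) = 0"
    using v(1) by (simp add: Bx inner_diff_right c_def norm_eq_sqrt_inner)
  ultimately have "(x \<bullet> (B *v v))\<^sup>2 \<le> 0" for x
    using psd_Cauchy_Schwarz[of B x v] by simp
  then have "(B *v v) \<bullet> (B *v v) = 0" by simp
  then have "A *v v = c *\<^sub>R v" by (simp add: Bx)
  then have "c \<in> eigenvalues A" using v(1) unfolding eigenvalues_def by (intro CollectI exI[of _ v]) auto
  then show ?thesis using that bound by blast
qed

lemma lambda_min_le:
  assumes "A \<in> sym_mats"
  shows "lambda_min A * (x \<bullet> x) \<le> x \<bullet> (A *v x)"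
proof -
  obtain c where c: "c \<in> eigenvalues A" "\<And>x. c * (x \<bullet> x) \<le> x \<bullet> (A *v x)"
    using exists_minimal_eigenvalue[OF assms] by blast
  have "lambda_min A \<le> c"
    unfolding lambda_min_def using c(1) eigenvalues_finite[OF assms] by simp
  then have "lambda_min A * (x \<bullet> x) \<le> c * (x \<bullet> x)" by (simp add: mult_right_mono)
  then show ?thesis using c(2)[of x] by simp
qed

text \<open>The least eigenvalue of -A, negated, is an eigenvalue of A that bounds the form from
  above.\<close>

lemma le_lambda_max:
  assumes "A \<in> sym_mats"
  shows "x \<bullet> (A *v x) \<le> lambda_max A * (x \<bullet> x)"
proof -
  have neg: "(- A) *v y = - (A *v y)" for y
    using matrix_vector_mult_diff_rdistrib[of 0 A y] by simp
  have "- A \<in> sym_mats" using subspace_neg[OF subspace_sym_mats assms] .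
  then obtain c where c: "c \<in> eigenvalues (- A)" "\<And>x. c * (x \<bullet> x) \<le> x \<bullet> ((- A) *v x)"
    using exists_minimal_eigenvalue by blast
  then obtain v where "v \<noteq> 0" "- (A *v v) = c *\<^sub>R v" by (auto simp: eigenvalues_def neg)
  then have "v \<noteq> 0" "A *v v = (- c) *\<^sub>R v" by (auto simp: minus_equation_iff[of "A *v v"])
  then have "- c \<in> eigenvalues A"
    unfolding eigenvalues_def by blast
  then have "- c \<le> lambda_max A"
    unfolding lambda_max_def using eigenvalues_finite[OF assms] by simp
  then have "- c * (x \<bullet> x) \<le> lambda_max A * (x \<bullet> x)" by (intro mult_right_mono) auto
  then show ?thesis using c(2)[of x] by (simp add: neg)
qed

text \<open>The form is the inner product of A with the rank-one matrix x x', whose Frobenius norm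
  is |x|^2.\<close>

lemma quadratic_form_norm_bound:
  fixes A :: "real^'n^'n"
  shows "\<bar>x \<bullet> (A *v x)\<bar> \<le> norm A * (x \<bullet> x)"
proof -
  have "norm (outer x) = x \<bullet> x"
  proof -
    have "(norm (outer x))\<^sup>2 = (x \<bullet> x)\<^sup>2"
      unfolding power2_norm_eq_inner
      by (simp add: outer_inner outer_mult_vec power2_eq_square)
    then show ?thesis by (simp add: power2_eq_iff_nonneg)
  qed
  then show ?thesis
    using Cauchy_Schwarz_ineq2[of "outer x" A] by (simp add: outer_inner mult.commute)
qed

text \<open>The strict spectral bounds leave a gap e on both sides, and a perturbation of Frobenius
  norm below e moves the form by at most e |x|^2, uniformly in x. This serves both the tail of the
  iterates and short segments starting at the minimiser.\<close>

lemma eventually_quadratic_form_bounds: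
  assumes A: "A \<in> sym_mats" and bounds: "l < lambda_min A" "lambda_max A < \<psi>"
  shows "eventually (\<lambda>B. \<forall>x. l * (x \<bullet> x) \<le> x \<bullet> (B *v x) \<and> x \<bullet> (B *v x) \<le> \<psi> * (x \<bullet> x)) (nhds A)"
proof -
  define e where "e = min (lambda_min A - l) (\<psi> - lambda_max A)"
  have "e > 0" using bounds by (simp add: e_def)
  moreover have "l * (x \<bullet> x) \<le> x \<bullet> (B *v x) \<and> x \<bullet> (B *v x) \<le> \<psi> * (x \<bullet> x)" if "dist B A < e" for B x
  proof -
    have "norm (B - A) * (x \<bullet> x) \<le> e * (x \<bullet> x)"
      using that by (intro mult_right_mono) (auto simp: dist_norm)
    then have "\<bar>x \<bullet> (B *v x) - x \<bullet> (A *v x)\<bar> \<le> e * (x \<bullet> x)"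
      using quadratic_form_norm_bound[of x "B - A"]
      by (simp add: matrix_vector_mult_diff_rdistrib inner_diff_right)
    moreover have "e * (x \<bullet> x) \<le> (lambda_min A - l) * (x \<bullet> x)" "e * (x \<bullet> x) \<le> (\<psi> - lambda_max A) * (x \<bullet> x)"
      by (intro mult_right_mono; simp add: e_def)+
    ultimately show ?thesis
      using lambda_min_le[OF A, of x] le_lambda_max[OF A, of x] by (simp add: algebra_simps abs_le_iff)
  qed
  ultimately show ?thesis unfolding eventually_nhds_metric by blast
qed

section \<open>Directional derivatives of the determinant and of the smooth objective\<close>

text \<open>In the Leibniz expansion only the identity permutation has a first-order term: any other
  permutation moves at least two indices, so its product has two factors vanishing at t = 0.\<close>

lemma has_field_derivative_det_at_identity:
  fixes X :: "real^'n^'n"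
  shows "((\<lambda>t. det (mat 1 + t *\<^sub>R X)) has_field_derivative trace X) (at 0)"
proof -
  let ?S = "{p. p permutes (UNIV :: 'n set)}"
  define F where "F t i j = (if i = j then 1 else 0) + t * X $ i $ j" for t i j
  have F: "((\<lambda>t. F t i j) has_field_derivative X $ i $ j) (at 0)" for i j
    unfolding F_def by (auto intro!: derivative_eq_intros)
  \<comment> \<open>By the product rule, \<open>d p\<close> is the derivative at 0 of the product
    belonging to p.\<close>
  define d where "d p = (\<Sum>i\<in>UNIV. X $ i $ p i * (\<Prod>k\<in>UNIV - {i}. F 0 k (p k)))" for p
  have d_id: "d id = trace X"
    by (simp add: d_def F_def trace_def)
  have d_other: "d p = 0" if "p permutes UNIV" "p \<noteq> id" for p
  proof -
    have prod_0: "(\<Prod>k\<in>UNIV - {i}. F 0 k (p k)) = 0" for i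
    proof -
      \<comment> \<open>Both j and p j are moved, so at least one moved index differs from i and
        contributes a zero factor.\<close>
      obtain j where j: "p j \<noteq> j" using \<open>p \<noteq> id\<close> by (auto simp: fun_eq_iff)
      moreover have "p (p j) \<noteq> p j"
        using j permutes_inj[OF that(1)] by (auto simp: inj_def)
      ultimately obtain k where "k \<noteq> i" "p k \<noteq> k" by metis
      then show ?thesis by (intro prod_zero) (auto simp: F_def intro!: bexI[of _ k])
    qed
    show ?thesis by (simp only: d_def prod_0 mult_zero_right sum.neutral_const)
  qed
  have "((\<lambda>t. \<Sum>p\<in>?S. of_int (sign p) * (\<Prod>i\<in>UNIV. F t i (p i))) has_field_derivative
      (\<Sum>p\<in>?S. of_int (sign p) * d p)) (at 0)"
    unfolding d_def by (intro DERIV_sum DERIV_cmult has_field_derivative_prod F)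
  moreover have "(\<Sum>p\<in>?S. of_int (sign p) * d p) = (\<Sum>p\<in>{id}. of_int (sign p) * d p)"
    by (intro sum.mono_neutral_right) (auto simp: permutes_id d_other finite_permutations)
  moreover have "(\<lambda>t. det (mat 1 + t *\<^sub>R X)) =
      (\<lambda>t. \<Sum>p\<in>?S. of_int (sign p) * (\<Prod>i\<in>UNIV. F t i (p i)))"
    by (simp add: det_def F_def mat_def fun_eq_iff)
  ultimately show ?thesis by (simp add: d_id sign_id)
qed

text \<open>The factorisation A + t H = A (I + t A^-1 H) reduces the derivative to the one at the
  identity. The logarithm splits for small t because the second determinant is then close to
  1.\<close>

lemma has_field_derivative_ln_det:
  fixes A H :: "real^'n^'n"
  assumes "invertible A"
  shows "((\<lambda>t. ln (det (A + t *\<^sub>R H))) has_field_derivative trace (matrix_inv A ** H)) (at 0)"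
proof -
  let ?X = "matrix_inv A ** H"
  let ?d = "\<lambda>t. det (mat 1 + t *\<^sub>R ?X)"
  have d: "(?d has_field_derivative trace ?X) (at 0)"
    by (rule has_field_derivative_det_at_identity)
  then have "((\<lambda>t. ln (det A) + ln (?d t)) has_field_derivative trace ?X) (at 0)"
    by (auto intro!: derivative_eq_intros)
  moreover have "eventually (\<lambda>t. ?d t > 0) (nhds 0)"
  proof -
    have "(?d \<longlongrightarrow> 1) (nhds 0)"
      using DERIV_isCont[OF d] tendsto_at_iff_tendsto_nhds[of ?d 0] by (simp add: isCont_def)
    then show ?thesis using order_tendstoD(1)[of ?d 1 "nhds 0" 0] by simp
  qed
  then have "eventually (\<lambda>t. ln (det (A + t *\<^sub>R H)) = ln (det A) + ln (?d t)) (nhds 0)"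
  proof eventually_elim
    case (elim t)
    have "A + t *\<^sub>R H = A ** (mat 1 + t *\<^sub>R ?X)"
      using assms by (simp add: matrix_add_ldistrib matrix_scalar_ac scalar_matrix_assoc[symmetric]
          matrix_mul_assoc matrix_inv_mult)
    then have "det (A + t *\<^sub>R H) = det A * ?d t" by (simp add: det_mul)
    then show ?case using elim assms by (simp add: ln_mult invertible_det_nz)
  qed
  ultimately show ?thesis by (subst DERIV_cong_ev[OF refl _ refl]) auto
qed

text \<open>Symmetry of S and of A^-1 turns both traces into inner products with H, which identifies
  the gradient as S - A^-1.\<close>

lemma has_field_derivative_f_obj:
  fixes A H S :: "real^'n^'n"
  assumes "A \<in> pd_mats" "S \<in> sym_mats"
  shows "((\<lambda>t. f_obj S (A + t *\<^sub>R H)) has_field_derivative (S - matrix_inv A) \<bullet> H) (at 0)"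
proof -
  have A: "A \<in> sym_mats" "invertible A" using assms pd_invertible by (auto simp: pd_mats_def)
  have "trace (B ** S) = S \<bullet> B" for B :: "real^'n^'n"
    using assms(2) trace_mul_sym[of B S] by (simp add: inner_eq_trace sym_mats_def)
  then have "((\<lambda>t. trace ((A + t *\<^sub>R H) ** S)) has_field_derivative S \<bullet> H) (at 0)"
    by (auto intro!: derivative_eq_intros simp: inner_add_right)
  moreover have "trace (matrix_inv A ** H) = matrix_inv A \<bullet> H"
    using matrix_inv_sym[OF A] by (simp add: inner_eq_trace sym_mats_def)
  ultimately show ?thesis
    unfolding f_obj_def using DERIV_add[OF DERIV_minus[OF has_field_derivative_ln_det[OF A(2), of H]]]
    by (fastforce simp: inner_diff_left)
qed

section \<open>Convexity of the penalty and first-order optimality\<close>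

text \<open>The penalty is a sum over entries of c |x| + d x^2 with c, d >= 0. The convexity gap of
  the square is exactly t (1 - t) (b - a)^2.\<close>

lemma g_pen_convex:
  assumes "lam \<ge> 0" "0 \<le> \<alpha>" "\<alpha> \<le> 1" "0 \<le> t" "t \<le> 1"
  shows "g_pen lam \<alpha> (A + t *\<^sub>R (B - A)) \<le> (1 - t) * g_pen lam \<alpha> A + t * g_pen lam \<alpha> B"
proof -
  define c d where "c = \<alpha> * lam" and "d = (1 - \<alpha>) / 2 * lam"
  define h where "h x = c * \<bar>x\<bar> + d * x\<^sup>2" for x :: real
  have cd: "c \<ge> 0" "d \<ge> 0" using assms by (auto simp: c_def d_def)
  have h: "h (a + t * (b - a)) \<le> (1 - t) * h a + t * h b" for a b
  proof -
    have "\<bar>a + t * (b - a)\<bar> = \<bar>(1 - t) * a + t * b\<bar>" by (simp add: algebra_simps)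
    also have "\<dots> \<le> (1 - t) * \<bar>a\<bar> + t * \<bar>b\<bar>"
      using abs_triangle_ineq[of "(1 - t) * a" "t * b"] assms by (simp add: abs_mult)
    finally have "c * \<bar>a + t * (b - a)\<bar> \<le> c * ((1 - t) * \<bar>a\<bar> + t * \<bar>b\<bar>)"
      using cd by (intro mult_left_mono) auto
    moreover have "(1 - t) * a\<^sup>2 + t * b\<^sup>2 - (a + t * (b - a))\<^sup>2 = t * (1 - t) * (b - a)\<^sup>2"
      by (simp add: power2_eq_square algebra_simps)
    then have "(a + t * (b - a))\<^sup>2 \<le> (1 - t) * a\<^sup>2 + t * b\<^sup>2"
      using assms by (smt (verit) mult_nonneg_nonneg zero_le_power2)
    then have "d * (a + t * (b - a))\<^sup>2 \<le> d * ((1 - t) * a\<^sup>2 + t * b\<^sup>2)"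
      using cd by (intro mult_left_mono) auto
    ultimately show ?thesis by (simp add: h_def algebra_simps)
  qed
  have g: "g_pen lam \<alpha> C = (\<Sum>i\<in>UNIV. \<Sum>j\<in>UNIV. h (C $ i $ j))" for C :: "real^'b^'b"
    by (simp add: g_pen_def h_def c_def d_def)
  show ?thesis
    unfolding g sum_distrib_left sum.distrib[symmetric]
    using h by (intro sum_mono) simp
qed

text \<open>G may have kinks, so only f is differentiated: convexity of G and minimality bound the
  difference quotient of f below by G A - G B, and t tends to 0 from the right. Minimality is asked
  only for small t, since the segment to B may leave the feasible set.\<close>

lemma minimizer_variational_inequality:
  fixes f :: "'a::real_normed_vector \<Rightarrow> real"
  assumes "\<forall>\<^sub>F t in at_right 0. f A + G A \<le> f (A + t *\<^sub>R (B - A)) + G (A + t *\<^sub>R (B - A))"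
    and "\<And>t. 0 \<le> t \<Longrightarrow> t \<le> 1 \<Longrightarrow> G (A + t *\<^sub>R (B - A)) \<le> (1 - t) * G A + t * G B"
    and "((\<lambda>t. f (A + t *\<^sub>R (B - A))) has_field_derivative D) (at 0)"
  shows "G A \<le> G B + D"
proof -
  have "((\<lambda>t. (f (A + t *\<^sub>R (B - A)) - f A) / t) \<longlongrightarrow> D) (at 0)"
    using assms(3) by (simp add: DERIV_def)
  then have "((\<lambda>t. (f (A + t *\<^sub>R (B - A)) - f A) / t) \<longlongrightarrow> D) (at_right 0)"
    by (rule filterlim_mono) (auto simp: at_le)
  moreover have "\<forall>\<^sub>F t in at_right (0::real). 0 < t \<and> t < 1"
    by (intro eventually_at_rightI[of 0 1]) auto
  with assms(1) have "\<forall>\<^sub>F t in at_right 0. G A - G B \<le> (f (A + t *\<^sub>R (B - A)) - f A) / t"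
  proof eventually_elim
    case (elim t)
    then have "t * (G A - G B) \<le> f (A + t *\<^sub>R (B - A)) - f A"
      using assms(2)[of t] by (simp add: algebra_simps)
    then show ?case using elim by (simp add: field_simps)
  qed
  ultimately have "G A - G B \<le> D" by (intro tendsto_lowerbound) auto
  then show ?thesis by simp
qed

lemma phi_obj_minimizer_optimality:
  fixes S A B :: "real^'n^'n"
  assumes min: "is_arg_min (phi_obj S lam \<alpha>) (\<lambda>u. u \<in> pd_mats) A"
    and S: "S \<in> sym_mats" and B: "B \<in> sym_mats"
    and pen: "lam \<ge> 0" "0 \<le> \<alpha>" "\<alpha> \<le> 1" and pos: "lambda_min A > 0"
  shows "g_pen lam \<alpha> A \<le> g_pen lam \<alpha> B + (S - matrix_inv A) \<bullet> (B - A)"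
proof (rule minimizer_variational_inequality[where f = "f_obj S"])
  have A: "A \<in> pd_mats" "A \<in> sym_mats" using min by (auto simp: is_arg_min_def pd_mats_def)
  let ?p = "\<lambda>t. A + t *\<^sub>R (B - A)"
  \<comment> \<open>Half of \<open>lambda_min A\<close> is still positive, so the segment stays
    positive definite for small t even when B is not; adding 1 to \<open>lambda_max A\<close> just
    makes the upper bound strict.\<close>
  have "eventually (\<lambda>C. \<forall>x. lambda_min A / 2 * (x \<bullet> x) \<le> x \<bullet> (C *v x) \<and>
      x \<bullet> (C *v x) \<le> (lambda_max A + 1) * (x \<bullet> x)) (nhds A)"
    by (rule eventually_quadratic_form_bounds[OF A(2)]) (use pos in auto)
  moreover have "(?p \<longlongrightarrow> A) (at_right 0)"
    by (auto intro!: tendsto_eq_intros)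
  ultimately have "\<forall>\<^sub>F t in at_right 0. \<forall>x. lambda_min A / 2 * (x \<bullet> x) \<le> x \<bullet> (?p t *v x) \<and>
      x \<bullet> (?p t *v x) \<le> (lambda_max A + 1) * (x \<bullet> x)"
    by (rule eventually_compose_filterlim)
  then show "\<forall>\<^sub>F t in at_right 0. f_obj S A + g_pen lam \<alpha> A \<le> f_obj S (?p t) + g_pen lam \<alpha> (?p t)"
  proof eventually_elim
    case (elim t)
    have "x \<bullet> (?p t *v x) > 0" if "x \<noteq> 0" for x
    proof -
      have "0 < lambda_min A / 2 * (x \<bullet> x)" using pos that by simp
      then show ?thesis using elim by (meson less_le_trans)
    qed
    moreover have "?p t \<in> sym_mats"
      by (intro subspace_add subspace_scale subspace_diff subspace_sym_mats A B)
    ultimately have "?p t \<in> pd_mats" by (simp add: pd_mats_def)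
    then show ?case using min by (simp add: is_arg_min_def phi_obj_def not_less)
  qed
  show "((\<lambda>t. f_obj S (?p t)) has_field_derivative (S - matrix_inv A) \<bullet> (B - A)) (at 0)"
    by (rule has_field_derivative_f_obj[OF A(1) S])
qed (rule g_pen_convex[OF pen])

section \<open>Existence and optimality of the proximal step\<close>

text \<open>\<open>T_map\<close> is a choice by \<open>arg_min\<close>, so its minimality rests on
  the existence of a minimiser. The objective is continuous and its sublevel set at the value of 0
  is bounded, so compactness supplies one.\<close>

lemma T_map_is_arg_min:
  fixes S A :: "real^'n^'n"
  assumes "lam \<ge> 0" "0 \<le> \<alpha>" "\<alpha> \<le> 1" "\<gamma> > 0"
  shows "is_arg_min (\<lambda>u. g_pen lam \<alpha> u
      + 1 / (2 * \<gamma>) * (norm (u - A + \<gamma> *\<^sub>R (S - matrix_inv A)))\<^sup>2)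
    (\<lambda>u. u \<in> sym_mats) (T_map S lam \<alpha> \<gamma> A)"
proof -
  define z where "z = A - \<gamma> *\<^sub>R (S - matrix_inv A)"
  define h where "h u = g_pen lam \<alpha> u + 1 / (2 * \<gamma>) * (norm (u - A + \<gamma> *\<^sub>R (S - matrix_inv A)))\<^sup>2" for u
  have h: "h u = g_pen lam \<alpha> u + 1 / (2 * \<gamma>) * (dist z u)\<^sup>2" for u
    by (simp add: h_def z_def dist_norm norm_minus_commute algebra_simps)
  have g_nonneg: "g_pen lam \<alpha> u \<ge> 0" for u :: "real^'n^'n"
    unfolding g_pen_def using assms by (intro sum_nonneg add_nonneg_nonneg mult_nonneg_nonneg) auto
  \<comment> \<open>As the penalty is nonnegative, \<open>h u\<close> <= \<open>h 0\<close> forces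
    dist(z, u)^2 <= 2 \<gamma> \<open>h 0\<close>.\<close>
  define R where "R = sqrt (2 * \<gamma> * h 0)"
  have h0: "h 0 \<ge> 0" unfolding h using assms g_nonneg by simp
  have R: "dist z u \<le> R" if "h u \<le> h 0" for u
  proof -
    have "1 / (2 * \<gamma>) * (dist z u)\<^sup>2 \<le> h 0" using that g_nonneg[of u] h[of u] by simp
    then show ?thesis using assms by (simp add: R_def real_le_rsqrt field_simps)
  qed
  let ?K = "cball z R \<inter> sym_mats"
  have "compact ?K" by (intro compact_Int_closed closed_subspace subspace_sym_mats) simp
  moreover have "0 \<in> ?K" using R[of 0] subspace_0[OF subspace_sym_mats] by simp
  moreover have "continuous_on ?K h"
    unfolding h_def g_pen_def by (intro continuous_intros)
  ultimately obtain p where p: "p \<in> ?K" "\<And>u. u \<in> ?K \<Longrightarrow> h p \<le> h u"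
    using continuous_attains_inf[of ?K h] by blast
  have "h p \<le> h u" if "u \<in> sym_mats" for u
  proof (cases "h u \<le> h 0")
    case True
    then show ?thesis using p(2) that R by simp
  next
    case False
    then show ?thesis using p(2)[OF \<open>0 \<in> ?K\<close>] by simp
  qed
  then have "is_arg_min h (\<lambda>u. u \<in> sym_mats) p"
    using p(1) by (auto simp: is_arg_min_def not_less)
  then have "is_arg_min h (\<lambda>u. u \<in> sym_mats) (arg_min h (\<lambda>u. u \<in> sym_mats))"
    unfolding arg_min_def by (rule someI)
  then show ?thesis by (simp add: T_map_def h_def[abs_def])
qed

text \<open>This is the variational inequality with the proximal quadratic as smooth part; its
  gradient at p is (p - w)/\<gamma>, where w is the point reached by the gradient step.\<close>

lemma T_map_optimality:
  fixes S A B :: "real^'n^'n"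
  assumes "lam \<ge> 0" "0 \<le> \<alpha>" "\<alpha> \<le> 1" "\<gamma> > 0" and B: "B \<in> sym_mats"
  defines "p \<equiv> T_map S lam \<alpha> \<gamma> A"
  shows "g_pen lam \<alpha> p \<le> g_pen lam \<alpha> B + (1 / \<gamma>) * ((p - A + \<gamma> *\<^sub>R (S - matrix_inv A)) \<bullet> (B - p))"
proof -
  define w where "w = A - \<gamma> *\<^sub>R (S - matrix_inv A)"
  define q where "q u = 1 / (2 * \<gamma>) * (norm (u - w))\<^sup>2" for u
  have min: "is_arg_min (\<lambda>u. g_pen lam \<alpha> u + q u) (\<lambda>u. u \<in> sym_mats) p"
    using T_map_is_arg_min[OF assms(1-4), of A S] by (simp add: p_def q_def w_def algebra_simps)
  then have p: "p \<in> sym_mats" by (simp add: is_arg_min_def)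
  have "p + t *\<^sub>R (B - p) \<in> sym_mats" for t
    by (intro subspace_add subspace_scale subspace_diff subspace_sym_mats p B)
  then have "q p + g_pen lam \<alpha> p \<le> q (p + t *\<^sub>R (B - p)) + g_pen lam \<alpha> (p + t *\<^sub>R (B - p))" for t
    using min by (simp add: is_arg_min_def not_less add.commute)
  moreover have "((\<lambda>t. q (p + t *\<^sub>R (B - p))) has_field_derivative 1 / \<gamma> * ((p - w) \<bullet> (B - p))) (at 0)"
  proof -
    have "(\<lambda>t. q (p + t *\<^sub>R (B - p))) = (\<lambda>t. 1 / (2 * \<gamma>) *
        ((p - w) \<bullet> (p - w) + 2 * t * ((p - w) \<bullet> (B - p)) + t\<^sup>2 * ((B - p) \<bullet> (B - p))))"
    proof
      fix t
      have "p + t *\<^sub>R (B - p) - w = (p - w) + t *\<^sub>R (B - p)" by simp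
      then show "q (p + t *\<^sub>R (B - p)) = 1 / (2 * \<gamma>) *
        ((p - w) \<bullet> (p - w) + 2 * t * ((p - w) \<bullet> (B - p)) + t\<^sup>2 * ((B - p) \<bullet> (B - p)))"
        unfolding q_def power2_norm_eq_inner
        by (simp only: inner_add_left inner_add_right inner_scaleR_left inner_scaleR_right
            inner_commute[of "B - p" "p - w"]) (simp add: algebra_simps power2_eq_square)
    qed
    then show ?thesis using \<open>\<gamma> > 0\<close> by (auto intro!: derivative_eq_intros)
  qed
  ultimately have "g_pen lam \<alpha> p \<le> g_pen lam \<alpha> B + 1 / \<gamma> * ((p - w) \<bullet> (B - p))"
    by (intro minimizer_variational_inequality[where f = q] g_pen_convex always_eventually)
      (use assms in auto)
  then show ?thesis by (simp add: w_def algebra_simps)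
qed

text \<open>The minimiser is a fixed point of \<open>T_map\<close>, and the proximal step is firmly nonexpansive;
  adding the two optimality inequalities gives both at once.\<close>

lemma T_map_dist_minimizer:
  fixes S A M :: "real^'n^'n"
  assumes min: "is_arg_min (phi_obj S lam \<alpha>) (\<lambda>u. u \<in> pd_mats) M" and "S \<in> sym_mats"
    and pen: "lam \<ge> 0" "0 \<le> \<alpha>" "\<alpha> \<le> 1" "\<gamma> > 0" and pos: "lambda_min M > 0"
  shows "norm (T_map S lam \<alpha> \<gamma> A - M) \<le> norm ((A - M) + \<gamma> *\<^sub>R (matrix_inv A - matrix_inv M))"
proof -
  define p where "p = T_map S lam \<alpha> \<gamma> A"
  define E where "E = (A - M) + \<gamma> *\<^sub>R (matrix_inv A - matrix_inv M)"
  have "p \<in> sym_mats" "M \<in> sym_mats"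
    using T_map_is_arg_min[OF pen, of A S] min by (auto simp: is_arg_min_def p_def pd_mats_def)
  then have "0 \<le> (S - matrix_inv M) \<bullet> (p - M) + 1 / \<gamma> * ((p - A + \<gamma> *\<^sub>R (S - matrix_inv A)) \<bullet> (M - p))"
    using phi_obj_minimizer_optimality[OF min \<open>S \<in> sym_mats\<close> _ pen(1-3) pos, of p]
      T_map_optimality[OF pen, of M S A] by (simp add: p_def)
  then have "0 \<le> \<gamma> * ((S - matrix_inv M) \<bullet> (p - M)) + (p - A + \<gamma> *\<^sub>R (S - matrix_inv A)) \<bullet> (M - p)"
    using \<open>\<gamma> > 0\<close> by (simp add: field_simps)
  also have "\<dots> = (\<gamma> *\<^sub>R (S - matrix_inv M) - (p - A + \<gamma> *\<^sub>R (S - matrix_inv A))) \<bullet> (p - M)"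
    by (simp add: inner_diff_left inner_diff_right algebra_simps)
  \<comment> \<open>S cancels, and only the difference of the two gradient steps remains.\<close>
  also have "\<gamma> *\<^sub>R (S - matrix_inv M) - (p - A + \<gamma> *\<^sub>R (S - matrix_inv A)) = E - (p - M)"
    by (simp add: E_def algebra_simps)
  finally have "(norm (p - M))\<^sup>2 \<le> E \<bullet> (p - M)"
    by (simp add: inner_diff_left power2_norm_eq_inner)
  also have "\<dots> \<le> norm E * norm (p - M)" by (rule norm_cauchy_schwarz)
  finally have "norm (p - M) * norm (p - M) \<le> norm E * norm (p - M)"
    by (simp add: power2_eq_square)
  then show ?thesis
    unfolding p_def[symmetric] E_def[symmetric]
    by (cases "norm (p - M) = 0") (auto simp: mult_le_cancel_right)
qed

section \<open>Linear convergence of the iterates\<close>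

theorem corollary5:
  fixes S theta_hat :: "real^'n^'n"
    and \<theta> :: "nat \<Rightarrow> real^'n^'n"
    and lam \<alpha> \<gamma> l \<psi> :: real
  assumes "S \<in> psd_mats"
    and "lam > 0"
    and "0 < \<alpha>" and "\<alpha> \<le> 1"
    and "is_arg_min (phi_obj S lam \<alpha>) (\<lambda>u. u \<in> pd_mats) theta_hat"
    and "0 < l" and "l < \<psi>"
    and "lambda_min theta_hat > l" and "lambda_max theta_hat < \<psi>"
    and "0 < \<gamma>" and "\<gamma> \<le> l\<^sup>2"
    and "\<And>j. \<theta> j \<in> pd_mats"
    and "\<And>j. \<theta> (Suc j) = T_map S lam \<alpha> \<gamma> (\<theta> j)"
    and "\<theta> \<longlonglongrightarrow> theta_hat"
  shows "\<exists>k0. \<forall>k\<ge>k0.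
    (norm (\<theta> k - theta_hat))\<^sup>2
      \<le> (1 - \<gamma> / \<psi>\<^sup>2) ^ (k - k0) * (norm (\<theta> k0 - theta_hat))\<^sup>2"
proof -
  have hat: "theta_hat \<in> pd_mats" "theta_hat \<in> sym_mats"
    using assms(5) by (auto simp: is_arg_min_def pd_mats_def)
  have S: "S \<in> sym_mats" using assms(1) by (simp add: psd_mats_def)
  note near = eventually_quadratic_form_bounds[OF hat(2) assms(8,9)]
  \<comment> \<open>A property that holds throughout a neighbourhood holds at its centre, so the
    same l and \<psi> serve for the limit.\<close>
  have hat_bounds: "l * (x \<bullet> x) \<le> x \<bullet> (theta_hat *v x)" "x \<bullet> (theta_hat *v x) \<le> \<psi> * (x \<bullet> x)" for x
    using eventually_nhds_x_imp_x[OF near] by auto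
  \<comment> \<open>Convergence places all iterates from \<open>k0\<close> on in the neighbourhood
    where the contraction applies.\<close>
  obtain k0 where k0: "\<And>k x. k \<ge> k0 \<Longrightarrow> l * (x \<bullet> x) \<le> x \<bullet> (\<theta> k *v x)"
      "\<And>k x. k \<ge> k0 \<Longrightarrow> x \<bullet> (\<theta> k *v x) \<le> \<psi> * (x \<bullet> x)"
    using eventually_compose_filterlim[OF near assms(14)] unfolding eventually_sequentially by blast
  have step: "(norm (\<theta> (Suc k) - theta_hat))\<^sup>2 \<le> (1 - \<gamma> / \<psi>\<^sup>2) * (norm (\<theta> k - theta_hat))\<^sup>2"
    if "k \<ge> k0" for k
  proof -
    have "(norm (\<theta> (Suc k) - theta_hat))\<^sup>2
        \<le> (norm ((\<theta> k - theta_hat) + \<gamma> *\<^sub>R (matrix_inv (\<theta> k) - matrix_inv theta_hat)))\<^sup>2"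
      using T_map_dist_minimizer[OF assms(5) S, of \<gamma> "\<theta> k"] assms by (intro power_mono) auto
    also have "\<dots> \<le> (1 - \<gamma> / \<psi>\<^sup>2) * (norm (\<theta> k - theta_hat))\<^sup>2"
      using assms by (intro gradient_step_contraction[of _ _ l] hat hat_bounds k0 that) auto
    finally show ?thesis .
  qed
  \<comment> \<open>The factor must be nonnegative for the induction hypothesis to be multiplied by
    it.\<close>
  have "l\<^sup>2 \<le> \<psi>\<^sup>2" using assms by (intro power_mono) auto
  with assms(11) have "\<gamma> \<le> \<psi>\<^sup>2" by linarith
  then have rate: "0 \<le> 1 - \<gamma> / \<psi>\<^sup>2" using assms by simp
  have "(norm (\<theta> k - theta_hat))\<^sup>2 \<le> (1 - \<gamma> / \<psi>\<^sup>2) ^ (k - k0) * (norm (\<theta> k0 - theta_hat))\<^sup>2"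
    if "k \<ge> k0" for k
    using that
  proof (induction k rule: dec_induct)
    case (step k)
    have "(norm (\<theta> (Suc k) - theta_hat))\<^sup>2
        \<le> (1 - \<gamma> / \<psi>\<^sup>2) * ((1 - \<gamma> / \<psi>\<^sup>2) ^ (k - k0) * (norm (\<theta> k0 - theta_hat))\<^sup>2)"
      using \<open>\<And>k. k \<ge> k0 \<Longrightarrow> (norm (\<theta> (Suc k) - theta_hat))\<^sup>2 \<le> _\<close>[OF step.hyps(1)]
        mult_left_mono[OF step.IH rate] by linarith
    then show ?case using step.hyps(1) by (simp add: Suc_diff_le mult.assoc)
  qed simp
  then show ?thesis by blast
qed

end
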